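(* Let $d\ge2$, let $\mathbb{L}\in\mathbb{R}^{d\times d}$ be symmetric with $\mathbb{L}\succeq0$ and $L:=\|\mathbb{L}\|>0$, and put $r_{\mathrm{eff}}:=\operatorname{tr}(\mathbb{L})/L$, $\delta_{\mathrm{diag}}:=\|\operatorname{diag}(\mathbb{L})\|/L$. For each of the Haar, Coordinate, and Gaussian sketches, with $\omega=\omega(r)$ and $\ell=\ell(r)$ the constants given in the context, the factor $\sqrt{\omega\ell r^2}$ is minimized over $r\in\{1,\dots,d\}$ at $r=1$. Denote by $Q_{\mathrm H},Q_{\mathrm C},Q_{\mathrm G}$ the values of the factor at $r=1$ for the Haar, Coordinate, and Gaussian sketches, respectively. Then: Values and ranges: $$Q_{\mathrm H}=d\sqrt{\frac{r_{\mathrm{eff}}+2}{d+2}},\qquad d\sqrt{\frac{3}{d+2}}\le Q_{\mathrm H}\le d,$$ $$Q_{\mathrm C}=d\sqrt{\delta_{\mathrm{diag}}},\qquad \sqrt d\le Q_{\mathrm C}\le d,$$ $$Q_{\mathrm G}=\sqrt{(d+2)(r_{\mathrm{eff}}+2)},\qquad \sqrt{3(d+2)}\le Q_{\mathrm G}\le d+2.$$ Relations between sketch factors: $$Q_{\mathrm G}=\Big(1+\frac2d\Big)Q_{\mathrm H},\qquad Q_{\mathrm H}\le\sqrt3\,Q_{\mathrm C}.$$ Moreover, for $\mathbb{L}=e_1e_1^\top$ (with $e_1$ the first standard basis vector), $$Q_{\mathrm H}=\sqrt{\frac{3}{d+2}}\;Q_{\mathrm C}.$$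
   Context: $\|\cdot\|$ on matrices is the operator norm induced by the Euclidean norm; $\operatorname{diag}(A)$ is the diagonal matrix with the same diagonal entries as $A$. The sketch-dependent constants, for $1\le r\le d$ and $\beta=\dfrac{d(d-r)}{(d+2)(d-1)}$, are: Haar: $\omega=\dfrac dr$, $\ell=\dfrac dr\Big(1-\beta+\beta\dfrac{r_{\mathrm{eff}}}{d}\Big)$, so $\sqrt{\omega\ell r^2}=d\sqrt{1-\beta+\beta\, r_{\mathrm{eff}}/d}$. Coordinate: $\omega=\dfrac dr$, $\ell=\dfrac dr\Big(\dfrac{r-1}{d-1}+\dfrac{d-r}{d-1}\delta_{\mathrm{diag}}\Big)$, so $\sqrt{\omega\ell r^2}=d\sqrt{\tfrac{r-1}{d-1}+\tfrac{d-r}{d-1}\delta_{\mathrm{diag}}}$. Gaussian: $\omega=\dfrac{d+r+1}{r}$, $\ell=\dfrac{r+1+r_{\mathrm{eff}}}{r}$, so $\sqrt{\omega\ell r^2}=\sqrt{(d+r+1)(r+1+r_{\mathrm{eff}})}$. *)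

theory Defs
  imports "HOL-Analysis.Analysis"
begin

text \<open>The index type \<open>'n\<close> plays the role of \<open>{1,\<dots>,d}\<close>, so \<open>d = CARD('n)\<close>.\<close>

definition opnorm :: "real^'n^'m \<Rightarrow> real" where
  "opnorm A = onorm ((*v) A)"

definition symmetric_mat :: "real^'n^'n \<Rightarrow> bool" where
  "symmetric_mat A \<longleftrightarrow> transpose A = A"

definition pos_semidef :: "real^'n^'n \<Rightarrow> bool" where
  "pos_semidef A \<longleftrightarrow> symmetric_mat A \<and> (\<forall>x. 0 \<le> x \<bullet> (A *v x))"

definition diag_part :: "real^'n^'n \<Rightarrow> real^'n^'n" where
  "diag_part A = (\<chi> i j. if i = j then A $ i $ j else 0)"

definition r_eff :: "real^'n^'n \<Rightarrow> real" where
  "r_eff A = trace A / opnorm A"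

definition delta_diag :: "real^'n^'n \<Rightarrow> real" where
  "delta_diag A = opnorm (diag_part A) / opnorm A"

datatype sketch = Haar | Coordinate | Gaussian

definition sketch_beta :: "nat \<Rightarrow> nat \<Rightarrow> real" where
  "sketch_beta d r = real d * (real d - real r) / ((real d + 2) * (real d - 1))"

fun sketch_omega :: "sketch \<Rightarrow> nat \<Rightarrow> nat \<Rightarrow> real" where
  "sketch_omega Haar d r = real d / real r"
| "sketch_omega Coordinate d r = real d / real r"
| "sketch_omega Gaussian d r = (real d + real r + 1) / real r"

fun sketch_ell :: "sketch \<Rightarrow> real^'n^'n \<Rightarrow> nat \<Rightarrow> real" where
  "sketch_ell Haar A r =
     (let d = CARD('n); \<beta> = sketch_beta d r
      in real d / real r * (1 - \<beta> + \<beta> * (r_eff A / real d)))"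
| "sketch_ell Coordinate A r =
     (let d = CARD('n)
      in real d / real r * ((real r - 1) / (real d - 1)
           + (real d - real r) / (real d - 1) * delta_diag A))"
| "sketch_ell Gaussian A r = (real r + 1 + r_eff A) / real r"

definition sketch_factor :: "sketch \<Rightarrow> real^'n^'n \<Rightarrow> nat \<Rightarrow> real" where
  "sketch_factor s A r = sqrt (sketch_omega s CARD('n) r * sketch_ell s A r * (real r)\<^sup>2)"

end

theory Submission
  imports Defs
begin

text \<open>
  For positive semidefinite \<open>A\<close>, the Cauchy--Schwarz inequality of the form \<open>x \<bullet> A y\<close> gives
  \<open>(A x)\<^sub>i\<^sup>2 \<le> A\<^sub>i\<^sub>i (x \<bullet> A x)\<close>. Summing over \<open>i\<close> yields \<open>\<bar>A x\<bar>\<^sup>2 \<le> tr A (x \<bullet> A x)\<close>, hence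
  \<open>\<parallel>A\<parallel> \<le> tr A\<close> without diagonalising \<open>A\<close>. Together with \<open>A\<^sub>i\<^sub>i \<le> \<parallel>diag A\<parallel> \<le> \<parallel>A\<parallel>\<close> this gives
  \<open>1 \<le> r_eff \<le> d \<delta>_diag \<le> d\<close>. The squared factors are explicit rational functions
  of \<open>d\<close>, \<open>r\<close>, \<open>r_eff\<close> and \<open>\<delta>_diag\<close>, and every claim reduces to these three inequalities.
\<close>

lemma norm_le_opnorm: "norm (A *v x) \<le> opnorm A * norm x"
  unfolding opnorm_def by (rule onorm[OF matrix_vector_mul_bounded_linear])

lemma opnorm_le: "(\<And>x. norm (A *v x) \<le> b * norm x) \<Longrightarrow> opnorm A \<le> b"
  unfolding opnorm_def by (rule onorm_le)

lemma matrix_vector_axis_nth: "(A *v axis j 1) $ i = (A $ i $ j :: real)"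
  by (simp add: matrix_vector_mult_basis column_def)

lemma entry_le_opnorm: "\<bar>A $ i $ j\<bar> \<le> opnorm A"
proof -
  have "\<bar>(A *v axis j 1) $ i\<bar> \<le> norm (A *v axis j 1)"
    by (rule component_le_norm_cart)
  also have "\<dots> \<le> opnorm A"
    using norm_le_opnorm[of A "axis j 1"] by (simp add: norm_axis_1)
  finally show ?thesis
    by (simp add: matrix_vector_axis_nth)
qed

lemma diag_le_opnorm_diag_part: "A $ i $ i \<le> opnorm (diag_part A)"
  using entry_le_opnorm[of "diag_part A" i i] by (simp add: diag_part_def)

lemma trace_le_opnorm_diag_part:
  fixes A :: "real^'n^'n"
  shows "trace A \<le> real CARD('n) * opnorm (diag_part A)"
  using sum_bounded_above[of UNIV "\<lambda>i. A $ i $ i" "opnorm (diag_part A)"]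
  by (simp add: trace_def diag_le_opnorm_diag_part)

lemma opnorm_nonneg: "0 \<le> opnorm A"
  unfolding opnorm_def by (rule onorm_pos_le[OF matrix_vector_mul_bounded_linear])

text \<open>The diagonal part multiplies the \<open>i\<close>-th coordinate by
  \<open>A $ i $ i\<close>, of modulus at most \<open>opnorm A\<close>, so the image of
  \<open>x\<close> is dominated coordinatewise by \<open>opnorm A *\<^sub>R x\<close>.\<close>

lemma opnorm_diag_part_le: "opnorm (diag_part A) \<le> opnorm A"
proof (rule opnorm_le)
  fix x
  have "\<bar>(diag_part A *v x) $ i\<bar> \<le> \<bar>(opnorm A *\<^sub>R x) $ i\<bar>" for i
  proof -
    have "(if i = j then A $ i $ j else 0) * x $ j = (if i = j then A $ i $ j * x $ j else 0)" for j
      by simp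
    then have "(diag_part A *v x) $ i = A $ i $ i * x $ i"
      by (simp add: matrix_vector_mult_def diag_part_def)
    then show ?thesis
      using mult_right_mono[OF entry_le_opnorm[of A i i], of "\<bar>x $ i\<bar>"] opnorm_nonneg[of A]
      by (simp add: abs_mult)
  qed
  then have "norm (diag_part A *v x) \<le> norm (opnorm A *\<^sub>R x)"
    by (intro norm_le_componentwise_cart) simp
  then show "norm (diag_part A *v x) \<le> opnorm A * norm x"
    using opnorm_nonneg[of A] by simp
qed

lemma pos_semidef_inner_commute:
  assumes "pos_semidef A"
  shows "x \<bullet> (A *v y) = y \<bullet> (A *v x)"
  using assms by (metis dot_lmul_matrix inner_commute pos_semidef_def symmetric_mat_def
      transpose_matrix_vector)

text \<open>Nonnegativity of the form at every \<open>s x + t y\<close> forces the bound. The form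
  may be degenerate, so \<open>c = 0\<close> is a separate case.\<close>

lemma pos_semidef_Cauchy_Schwarz:
  assumes "pos_semidef A"
  shows "(x \<bullet> (A *v y))\<^sup>2 \<le> (x \<bullet> (A *v x)) * (y \<bullet> (A *v y))"
proof -
  define a b c where "a = x \<bullet> (A *v x)" and "b = x \<bullet> (A *v y)" and "c = y \<bullet> (A *v y)"
  have yx: "y \<bullet> (A *v x) = b"
    unfolding b_def by (rule pos_semidef_inner_commute[OF assms])
  have q: "0 \<le> s\<^sup>2 * a + 2 * s * t * b + t\<^sup>2 * c" for s t
  proof -
    have "0 \<le> (s *\<^sub>R x + t *\<^sub>R y) \<bullet> (A *v (s *\<^sub>R x + t *\<^sub>R y))"
      using assms by (simp add: pos_semidef_def)
    also have "\<dots> = s\<^sup>2 * a + 2 * s * t * b + t\<^sup>2 * c"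
      using yx by (simp add: matrix_vector_right_distrib matrix_vector_mult_scaleR inner_add_left
          inner_add_right a_def[symmetric] b_def[symmetric] c_def[symmetric]
          power2_eq_square algebra_simps)
    finally show ?thesis .
  qed
  have "b\<^sup>2 \<le> a * c"
  proof (cases "c = 0")
    case True
    have "b = 0"
    proof (rule ccontr)
      assume "b \<noteq> 0"
      \<comment> \<open>With \<open>s = 1\<close> and \<open>c = 0\<close> the quadratic is
        \<open>a + 2 * t * b\<close>, linear in \<open>t\<close>; this \<open>t\<close> makes it
        equal to \<open>-1\<close>.\<close>
      then show False
        using q[of 1 "- (a + 1) / (2 * b)"] True by (simp add: field_simps)
    qed
    then show ?thesis
      using True by simp
  next
    case False
    then have "0 < c"
      using q[of 0 1] by simp
    \<comment> \<open>Up to scaling, \<open>s = c\<close> and \<open>t = - b\<close> minimize the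
      form over \<open>t\<close>, leaving \<open>c\<close> times the desired difference.\<close>
    have "0 \<le> c * (a * c - b\<^sup>2)"
      using q[of c "- b"] by (simp add: power2_eq_square algebra_simps)
    then show ?thesis
      using \<open>0 < c\<close> by (simp add: zero_le_mult_iff)
  qed
  then show ?thesis
    by (simp add: a_def b_def c_def)
qed

lemma pos_semidef_norm_square_le:
  assumes "pos_semidef A"
  shows "(norm (A *v x))\<^sup>2 \<le> trace A * (x \<bullet> (A *v x))"
proof -
  have "((A *v x) $ i)\<^sup>2 \<le> A $ i $ i * (x \<bullet> (A *v x))" for i
    using pos_semidef_Cauchy_Schwarz[OF assms, of "axis i 1" x]
    by (simp add: inner_axis' matrix_vector_axis_nth)
  then have "(\<Sum>i\<in>UNIV. ((A *v x) $ i)\<^sup>2) \<le> (\<Sum>i\<in>UNIV. A $ i $ i * (x \<bullet> (A *v x)))"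
    by (intro sum_mono)
  then show ?thesis
    by (simp add: norm_vec_def L2_set_def sum_nonneg trace_def sum_distrib_right)
qed

lemma pos_semidef_opnorm_le_trace:
  assumes "pos_semidef A"
  shows "opnorm A \<le> trace A"
proof (rule opnorm_le)
  fix x
  have "0 \<le> A $ i $ i" for i
    using assms[unfolded pos_semidef_def, THEN conjunct2, rule_format, of "axis i 1"]
    by (simp add: inner_axis' matrix_vector_axis_nth)
  then have trace: "0 \<le> trace A"
    by (simp add: trace_def sum_nonneg)
  have "(norm (A *v x))\<^sup>2 \<le> trace A * (x \<bullet> (A *v x))"
    by (rule pos_semidef_norm_square_le[OF assms])
  also have "\<dots> \<le> trace A * (norm x * norm (A *v x))"
    using trace by (intro mult_left_mono norm_cauchy_schwarz)
  finally have "norm (A *v x) * norm (A *v x) \<le> (trace A * norm x) * norm (A *v x)"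
    by (simp add: power2_eq_square algebra_simps)
  \<comment> \<open>The common factor \<open>norm (A *v x)\<close> cancels unless it is zero, where
    a nonnegative trace suffices.\<close>
  then show "norm (A *v x) \<le> trace A * norm x"
    using trace by (cases "norm (A *v x) = 0") (auto simp: mult_le_cancel_right)
qed

lemma r_eff_ge_1:
  assumes "pos_semidef A" "0 < opnorm A"
  shows "1 \<le> r_eff A"
  using assms pos_semidef_opnorm_le_trace[OF assms(1)] by (simp add: r_eff_def)

lemma r_eff_le_delta_diag:
  fixes A :: "real^'n^'n"
  shows "r_eff A \<le> real CARD('n) * delta_diag A"
  using divide_right_mono[OF trace_le_opnorm_diag_part opnorm_nonneg, of A A]
  by (simp add: r_eff_def delta_diag_def)

lemma delta_diag_le_1:
  assumes "0 < opnorm A"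
  shows "delta_diag A \<le> 1"
  using assms opnorm_diag_part_le[of A] by (simp add: delta_diag_def)

text \<open>Affine in \<open>r\<close>, the radicand is expanded around \<open>r = 1\<close>: the
  first term is the value there, and the slope is nonnegative once \<open>e \<le> d\<close>, which
  gives minimality.\<close>

lemma haar_radicand_eq:
  assumes "2 \<le> (d::real)"
  shows "1 - d * (d - r) / ((d + 2) * (d - 1)) + d * (d - r) / ((d + 2) * (d - 1)) * (e / d)
    = (e + 2) / (d + 2) + (r - 1) * (d - e) / ((d + 2) * (d - 1))"
  using assms by (simp add: divide_simps) algebra

lemma sketch_factor_Haar:
  fixes A :: "real^'n^'n"
  assumes "d = CARD('n)" "2 \<le> d" "1 \<le> r"
  shows "sketch_factor Haar A r = real d * sqrt ((r_eff A + 2) / (real d + 2)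
    + (real r - 1) * (real d - r_eff A) / ((real d + 2) * (real d - 1)))"
proof -
  have "sketch_omega Haar d r * sketch_ell Haar A r * (real r)\<^sup>2 = (real d)\<^sup>2 *
      ((r_eff A + 2) / (real d + 2) + (real r - 1) * (real d - r_eff A) / ((real d + 2) * (real d - 1)))"
    using assms haar_radicand_eq[of "real d" "real r" "r_eff A"]
    by (simp add: Let_def sketch_beta_def power2_eq_square)
  then show ?thesis
    using assms(1) by (simp add: sketch_factor_def real_sqrt_mult)
qed

lemma sketch_factor_Coordinate:
  fixes A :: "real^'n^'n"
  assumes "d = CARD('n)" "1 \<le> r"
  shows "sketch_factor Coordinate A r = real d * sqrt ((real r - 1) / (real d - 1)
    + (real d - real r) / (real d - 1) * delta_diag A)"
proof -
  have "sketch_omega Coordinate d r * sketch_ell Coordinate A r * (real r)\<^sup>2 = (real d)\<^sup>2 *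
      ((real r - 1) / (real d - 1) + (real d - real r) / (real d - 1) * delta_diag A)"
    using assms by (simp add: Let_def power2_eq_square)
  then show ?thesis
    using assms(1) by (simp add: sketch_factor_def real_sqrt_mult)
qed

lemma sketch_factor_Gaussian:
  fixes A :: "real^'n^'n"
  assumes "d = CARD('n)" "1 \<le> r"
  shows "sketch_factor Gaussian A r = sqrt ((real d + real r + 1) * (real r + 1 + r_eff A))"
  using assms by (simp add: sketch_factor_def power2_eq_square)

lemma sketch_factor_minimal:
  fixes A :: "real^'n^'n"
  assumes d: "d = CARD('n)" "2 \<le> d" and r: "r \<in> {1..d}"
    and e: "1 \<le> r_eff A" "r_eff A \<le> real d" and \<delta>: "delta_diag A \<le> 1"
  shows "sketch_factor s A 1 \<le> sketch_factor s A r"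
proof (cases s)
  case Haar
  then show ?thesis
    using assms by (simp add: sketch_factor_Haar[OF d])
next
  case Coordinate
  \<comment> \<open>The radicand is a convex combination of \<open>1\<close> and
    \<open>delta_diag A\<close>, hence at least the smaller value \<open>delta_diag A\<close>,
    attained at \<open>r = 1\<close>.\<close>
  have "(real r - 1) * delta_diag A \<le> real r - 1"
    using r \<delta> by (simp add: mult_left_le)
  then have "delta_diag A \<le> (real r - 1) / (real d - 1)
      + (real d - real r) / (real d - 1) * delta_diag A"
    using d by (simp add: pos_le_divide_eq algebra_simps flip: add_divide_distrib)
  then show ?thesis
    using Coordinate d r by (simp add: sketch_factor_Coordinate[OF d(1)])
next
  case Gaussian
  \<comment> \<open>Both factors increase with \<open>r\<close>, and \<open>1 \<le> r_eff A\<close>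
    keeps them nonnegative.\<close>
  have "(real d + 2) * (2 + r_eff A) \<le> (real d + real r + 1) * (real r + 1 + r_eff A)"
    using r e by (intro mult_mono) auto
  then show ?thesis
    using Gaussian r by (simp add: sketch_factor_Gaussian[OF d(1)] add_ac)
qed

text \<open>
  The type of \<open>columnvector\<close> leaves the number \<open>m\<close> of columns open, so the product below is
  \<open>m\<close> times the matrix unit at \<open>(i, i)\<close>; the relation between \<open>Q\<^sub>H\<close> and \<open>Q\<^sub>C\<close> is invariant
  under this scaling.
\<close>

lemma columnvector_rowvector_axis_nth:
  "((columnvector (axis i 1) :: real^'m^'n) ** rowvector (axis i 1)) $ k $ l
    = (if k = i \<and> l = i then real CARD('m) else 0)"
  by (auto simp: matrix_matrix_mult_def columnvector_def rowvector_def axis_def)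

lemma columnvector_rowvector_axis_trace_diag_part:
  fixes A :: "real^'n^'n"
  assumes "A = columnvector (axis i 1) ** rowvector (axis i 1)"
  shows "trace A = A $ i $ i" "diag_part A = A"
  using assms by (auto simp: trace_def diag_part_def vec_eq_iff columnvector_rowvector_axis_nth)

theorem proposition5p2:
  fixes A :: "real^'n^'n" and d :: nat and Q\<^sub>H Q\<^sub>C Q\<^sub>G :: real
  assumes d_def: "d = CARD('n)" and d_ge_2: "d \<ge> 2"
    and sym: "symmetric_mat A" and psd: "pos_semidef A" and norm_pos: "opnorm A > 0"
    and QH: "Q\<^sub>H = sketch_factor Haar A 1"
    and QC: "Q\<^sub>C = sketch_factor Coordinate A 1"
    and QG: "Q\<^sub>G = sketch_factor Gaussian A 1"
  shows "(\<forall>s. \<forall>r\<in>{1..d}. sketch_factor s A 1 \<le> sketch_factor s A r)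
    \<and> Q\<^sub>H = real d * sqrt ((r_eff A + 2) / (real d + 2))
    \<and> real d * sqrt (3 / (real d + 2)) \<le> Q\<^sub>H \<and> Q\<^sub>H \<le> real d
    \<and> Q\<^sub>C = real d * sqrt (delta_diag A)
    \<and> sqrt (real d) \<le> Q\<^sub>C \<and> Q\<^sub>C \<le> real d
    \<and> Q\<^sub>G = sqrt ((real d + 2) * (r_eff A + 2))
    \<and> sqrt (3 * (real d + 2)) \<le> Q\<^sub>G \<and> Q\<^sub>G \<le> real d + 2
    \<and> Q\<^sub>G = (1 + 2 / real d) * Q\<^sub>H
    \<and> Q\<^sub>H \<le> sqrt 3 * Q\<^sub>C
    \<and> (\<forall>i::'n. A = columnvector (axis i 1) ** rowvector (axis i 1)
          \<longrightarrow> Q\<^sub>H = sqrt (3 / (real d + 2)) * Q\<^sub>C)"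
proof (intro conjI ballI allI impI)
  define e \<delta> D where "e = r_eff A" and "\<delta> = delta_diag A" and "D = real d"
  have D: "2 \<le> D"
    using d_ge_2 by (simp add: D_def)
  have e1: "1 \<le> e"
    unfolding e_def by (rule r_eff_ge_1[OF psd norm_pos])
  have e\<delta>: "e \<le> D * \<delta>"
    using r_eff_le_delta_diag[of A] by (simp add: e_def \<delta>_def D_def d_def)
  have \<delta>1: "\<delta> \<le> 1"
    unfolding \<delta>_def by (rule delta_diag_le_1[OF norm_pos])
  have eD: "e \<le> D"
    using e\<delta> mult_left_mono[OF \<delta>1, of D] D by linarith
  show "sketch_factor s A 1 \<le> sketch_factor s A r" if "r \<in> {1..d}" for s r
    using sketch_factor_minimal[OF d_def d_ge_2 that] e1 eD \<delta>1
    by (simp add: e_def \<delta>_def D_def)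
  show H: "Q\<^sub>H = real d * sqrt ((r_eff A + 2) / (real d + 2))"
    by (simp add: QH sketch_factor_Haar[OF d_def d_ge_2])
  show C: "Q\<^sub>C = real d * sqrt (delta_diag A)"
    using d_ge_2 by (simp add: QC sketch_factor_Coordinate[OF d_def])
  show G: "Q\<^sub>G = sqrt ((real d + 2) * (r_eff A + 2))"
    by (simp add: QG sketch_factor_Gaussian[OF d_def] add_ac)
  note H' = H[folded e_def D_def] and C' = C[folded \<delta>_def D_def] and G' = G[folded e_def D_def]
  show "real d * sqrt (3 / (real d + 2)) \<le> Q\<^sub>H"
    unfolding H' D_def[symmetric] using D e1
    by (intro mult_left_mono) (auto simp: divide_right_mono)
  show "Q\<^sub>H \<le> real d"
    unfolding H' D_def[symmetric] using D eD by (simp add: mult_left_le)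
  show "Q\<^sub>C \<le> real d"
    unfolding C' D_def[symmetric] using D \<delta>1 by (simp add: mult_left_le)
  \<comment> \<open>The chain \<open>1 \<le> e \<le> D * \<delta>\<close>, multiplied by
    \<open>D\<close>.\<close>
  have "sqrt D \<le> sqrt (D\<^sup>2 * \<delta>)"
    using D mult_left_mono[of 1 "D * \<delta>" D] e1 e\<delta> by (simp add: power2_eq_square mult.assoc)
  then show "sqrt (real d) \<le> Q\<^sub>C"
    unfolding C' D_def[symmetric] using D by (simp add: real_sqrt_mult)
  show "sqrt (3 * (real d + 2)) \<le> Q\<^sub>G"
    unfolding G' D_def[symmetric] using D e1 mult_left_mono[of 3 "e + 2" "D + 2"]
    by (simp add: mult.commute)
  show "Q\<^sub>G \<le> real d + 2"
    unfolding G' D_def[symmetric] using D eD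
    by (intro real_le_lsqrt) (auto simp: power2_eq_square)
  \<comment> \<open>Pulling out a square exposes the root occurring in \<open>Q\<^sub>H\<close>, so
    the ratio of the factors is \<open>(D + 2) / D\<close>.\<close>
  have "(D + 2) * (e + 2) = (D + 2)\<^sup>2 * ((e + 2) / (D + 2))"
    using D by (simp add: power2_eq_square)
  then have "Q\<^sub>G = (D + 2) * sqrt ((e + 2) / (D + 2))"
    unfolding G' using D by (simp only: real_sqrt_mult real_sqrt_abs)
  then show "Q\<^sub>G = (1 + 2 / real d) * Q\<^sub>H"
    unfolding H' D_def[symmetric] using D by (simp add: field_simps)
  \<comment> \<open>The constant 3 arises here: \<open>1 \<le> e\<close> gives
    \<open>e + 2 \<le> 3 * e\<close>, and the denominator shrinks to \<open>D\<close>.\<close>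
  have "(e + 2) / (D + 2) \<le> 3 * e / D"
    using D e1 by (intro frac_le) auto
  also have "\<dots> \<le> 3 * \<delta>"
    using D e\<delta> by (simp add: field_simps)
  finally have "sqrt ((e + 2) / (D + 2)) \<le> sqrt 3 * sqrt \<delta>"
    by (simp flip: real_sqrt_mult)
  then show "Q\<^sub>H \<le> sqrt 3 * Q\<^sub>C"
    unfolding H' C' using D mult_left_mono[of "sqrt ((e + 2) / (D + 2))" "sqrt 3 * sqrt \<delta>" D]
    by (simp add: algebra_simps)
  show "Q\<^sub>H = sqrt (3 / (real d + 2)) * Q\<^sub>C"
    if A: "A = columnvector (axis i 1) ** rowvector (axis i 1)" for i :: 'n
  proof -
    \<comment> \<open>A single diagonal entry carries the whole trace, so
      \<open>trace A = A $ i $ i \<le> opnorm A \<le> trace A\<close>.\<close>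
    have "opnorm A = trace A"
      using pos_semidef_opnorm_le_trace[OF psd] entry_le_opnorm[of A i i]
        columnvector_rowvector_axis_trace_diag_part(1)[OF A] by simp
    then have "e = 1" "\<delta> = 1"
      using norm_pos columnvector_rowvector_axis_trace_diag_part(2)[OF A]
      by (simp_all add: e_def \<delta>_def r_eff_def delta_diag_def)
    then show ?thesis
      unfolding H' C' by (simp add: D_def)
  qed
qed

end
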